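(* Let $m\ge 1$ be an integer. Let $p\colon E\to B$ and $p'\colon E'\to B'$ be fibrations, and let $f\colon B'\to B$ and $f'\colon E'\to E$ be continuous maps such that $p\circ f'\simeq f\circ p'$ (the square commutes up to homotopy). (1) If $f$ admits a right homotopy inverse (i.e. there is $g\colon B\to B'$ with $f\circ g\simeq \mathrm{id}_B$), then $\mathrm{secat}_m(p)\le \mathrm{secat}_m(p')$. (2) If $f$ is a homotopy equivalence and $f'$ admits a right homotopy inverse, then $\mathrm{secat}_m(p)=\mathrm{secat}_m(p')$. In particular, $\mathrm{secat}_m$ is a fibre-preserving homotopy invariant: if two fibrations $p$ and $p'$ are fibre-preserving homotopy equivalent, then $\mathrm{secat}_m(p)=\mathrm{secat}_m(p')$.
   Context: A fibration is a map with the homotopy lifting property. For a fibration $p\colon E\to B$, the $m$-sectional category $\mathrm{secat}_m(p)$ is the least integer $k$ such that $B$ admits an open cover $\{U_i\}_{i=0}^k$ with the property: for each $i$, every $m$-dimensional CW complex $P$ and every map $\phi\colon P\to U_i$, there is a map $s\colon P\to E$ with $p\circ s=\iota_{U_i}\circ\phi$, where $\iota_{U_i}\colon U_i\hookrightarrow B$ is the inclusion. If no such cover exists, $\mathrm{secat}_m(p)=\infty$. A fibre-preserving map $(f,g)\colon p\to p'$ between fibrations $p\colon E\to B$, $p'\colon E'\to B'$ is a pair of maps $f\colon E\to E'$, $g\colon B\to B'$ with $p'\circ f=g\circ p$. A fibre-preserving homotopy is a pair of maps $F\colon E\times I\to E'$, $G\colon B\times I\to B'$ with $p'\circ F=G\circ(p\times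 \mathrm{id}_I)$. The fibrations $p$ and $p'$ are fibre-preserving homotopy equivalent if there are fibre-preserving maps $(f,g)\colon p\to p'$ and $(f',g')\colon p'\to p$ such that $(f\circ f',g\circ g')$ is fibre-preserving homotopic to $(\mathrm{id}_{E'},\mathrm{id}_{B'})$ and $(f'\circ f,g'\circ g)$ is fibre-preserving homotopic to $(\mathrm{id}_E,\mathrm{id}_B)$. *)

theory Defs
  imports "HOL-Analysis.Analysis"
begin

section \<open>Fibrations\<close>

abbreviation cylinder :: "'a topology \<Rightarrow> (real \<times> 'a) topology"
  where "cylinder X \<equiv> prod_topology (top_of_set {0..1::real}) X"

definition homotopy_lifting ::
    "'x topology \<Rightarrow> 'e topology \<Rightarrow> 'b topology \<Rightarrow> ('e \<Rightarrow> 'b) \<Rightarrow> bool"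
  where "homotopy_lifting X E B p \<longleftrightarrow>
    (\<forall>h k. continuous_map (cylinder X) B h \<and> continuous_map X E k \<and>
           (\<forall>x\<in>topspace X. p (k x) = h (0, x)) \<longrightarrow>
      (\<exists>H. continuous_map (cylinder X) E H \<and>
           (\<forall>x\<in>topspace X. H (0, x) = k x) \<and>
           (\<forall>z\<in>topspace (cylinder X). p (H z) = h z)))"

text \<open>The homotopy lifting property is required for all spaces. A HOL definition cannot
  quantify over types, so the test spaces are the topological spaces with points in
  \<open>'e \<times> (real \<Rightarrow> 'b)\<close>. Theorem \<open>fibration_homotopy_lifting\<close> below shows that this already
  gives the property for every space over every type.\<close>

definition fibration :: "'e topology \<Rightarrow> 'b topology \<Rightarrow> ('e \<Rightarrow> 'b) \<Rightarrow> bool"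
  where "fibration E B p \<longleftrightarrow>
    continuous_map E B p \<and> (\<forall>X :: ('e \<times> (real \<Rightarrow> 'b)) topology. homotopy_lifting X E B p)"

lemma continuous_map_in_topspace:
  "continuous_map X Y f \<Longrightarrow> x \<in> topspace X \<Longrightarrow> f x \<in> topspace Y"
  using continuous_map_image_subset_topspace by blast

lemma exists_quotient_topology:
  fixes X :: "'a topology" and f :: "'a \<Rightarrow> 'c"
  shows "\<exists>Y. quotient_map X Y f"
proof -
  define op where "op = (\<lambda>T. T \<subseteq> f ` topspace X \<and> openin X {x \<in> topspace X. f x \<in> T})"
  have ist: "istopology op"
    unfolding istopology_def
  proof (intro conjI allI impI)
    fix S T assume "op S" "op T"
    then have "openin X ({x \<in> topspace X. f x \<in> S} \<inter> {x \<in> topspace X. f x \<in> T})"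
      by (auto simp: op_def)
    moreover have "{x \<in> topspace X. f x \<in> S} \<inter> {x \<in> topspace X. f x \<in> T}
                 = {x \<in> topspace X. f x \<in> S \<inter> T}" by auto
    ultimately show "op (S \<inter> T)"
      using \<open>op S\<close> by (auto simp: op_def)
  next
    fix K assume "\<forall>T\<in>K. op T"
    then have "openin X (\<Union>T\<in>K. {x \<in> topspace X. f x \<in> T})"
      by (intro openin_Union) (auto simp: op_def)
    moreover have "(\<Union>T\<in>K. {x \<in> topspace X. f x \<in> T}) = {x \<in> topspace X. f x \<in> \<Union>K}" by auto
    ultimately show "op (\<Union>K)"
      using \<open>\<forall>T\<in>K. op T\<close> by (auto simp: op_def)
  qed
  define Y where "Y = topology op"
  have op: "openin Y T \<longleftrightarrow> op T" for T
    using ist by (simp add: Y_def topology_inverse')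
  have "op (f ` topspace X)"
  proof -
    have "{x \<in> topspace X. f x \<in> f ` topspace X} = topspace X" by auto
    then show ?thesis by (simp add: op_def)
  qed
  then have "f ` topspace X \<subseteq> topspace Y"
    by (simp add: openin_subset flip: op)
  moreover have "op (topspace Y)" by (simp flip: op)
  ultimately have top: "topspace Y = f ` topspace X"
    by (simp add: op_def subset_antisym)
  have "quotient_map X Y f"
    unfolding quotient_map_def top op op_def by auto
  then show ?thesis ..
qed

theorem fibration_homotopy_lifting:
  fixes X :: "'x topology" and E :: "'e topology" and B :: "'b topology"
  assumes fib: "fibration E B p"
  shows "homotopy_lifting X E B p"
  unfolding homotopy_lifting_def
proof (intro allI impI, elim conjE)
  fix h k
  assume h: "continuous_map (cylinder X) B h" and k: "continuous_map X E k"
    and start: "\<forall>x\<in>topspace X. p (k x) = h (0, x)"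
  define f :: "'x \<Rightarrow> 'e \<times> (real \<Rightarrow> 'b)" where "f = (\<lambda>x. (k x, \<lambda>t. h (t, x)))"
  obtain Y where q: "quotient_map X Y f"
    using exists_quotient_topology by blast
  have fim: "f ` topspace X = topspace Y"
    using q by (simp add: quotient_map_def)
  have qI: "quotient_map (cylinder X) (cylinder Y) (\<lambda>(t, x). (t, f x))"
  proof (rule quotient_map_prod_right[OF _ _ q])
    show "locally_compact_space (top_of_set {0..1::real})"
      by (simp add: compact_imp_locally_compact_space compact_space_subtopology)
    show "Hausdorff_space (top_of_set {0..1::real}) \<or> regular_space (top_of_set {0..1::real})"
      by (simp add: Hausdorff_space_subtopology)
  qed
  define h' :: "real \<times> 'e \<times> (real \<Rightarrow> 'b) \<Rightarrow> 'b" where "h' = (\<lambda>(t, e, w). w t)"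
  define k' :: "'e \<times> (real \<Rightarrow> 'b) \<Rightarrow> 'e" where "k' = fst"
  have "h' \<circ> (\<lambda>(t, x). (t, f x)) = h"
    by (auto simp: h'_def f_def)
  then have h': "continuous_map (cylinder Y) B h'"
    using continuous_compose_quotient_map_eq[OF qI] h by metis
  have "k' \<circ> f = k"
    by (auto simp: k'_def f_def)
  then have k': "continuous_map Y E k'"
    using continuous_compose_quotient_map_eq[OF q] k by metis
  have start': "\<forall>y\<in>topspace Y. p (k' y) = h' (0, y)"
    using start by (auto simp: h'_def k'_def f_def simp flip: fim)
  obtain H where H: "continuous_map (cylinder Y) E H"
      "\<forall>y\<in>topspace Y. H (0, y) = k' y" "\<forall>z\<in>topspace (cylinder Y). p (H z) = h' z"
    using fib[unfolded fibration_def, THEN conjunct2, THEN spec[of _ Y],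
        unfolded homotopy_lifting_def, THEN spec[of _ h'], THEN spec[of _ k']] h' k' start' by blast
  let ?H = "H \<circ> (\<lambda>(t, x). (t, f x))"
  have "continuous_map (cylinder X) E ?H"
    using continuous_map_compose[OF quotient_imp_continuous_map[OF qI] H(1)] .
  moreover have "\<forall>x\<in>topspace X. ?H (0, x) = k x"
    using H(2) by (auto simp: k'_def f_def simp flip: fim)
  moreover have "\<forall>z\<in>topspace (cylinder X). p (?H z) = h z"
    using H(3) by (auto simp: h'_def f_def simp flip: fim)
  ultimately show "\<exists>H. continuous_map (cylinder X) E H \<and> (\<forall>x\<in>topspace X. H (0, x) = k x) \<and>
           (\<forall>z\<in>topspace (cylinder X). p (H z) = h z)"
    by blast
qed

section \<open>Finite-dimensional CW complexes\<close>

definition disc :: "nat \<Rightarrow> (nat \<Rightarrow> real) topology"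
  where "disc n = subtopology (Euclidean_space n) {x. (\<Sum>i<n. (x i)\<^sup>2) \<le> 1}"

definition disc_boundary :: "nat \<Rightarrow> (nat \<Rightarrow> real) set"
  where "disc_boundary n = {x \<in> topspace (disc n). (\<Sum>i<n. (x i)\<^sup>2) = 1}"

definition disc_interior :: "nat \<Rightarrow> (nat \<Rightarrow> real) set"
  where "disc_interior n = {x \<in> topspace (disc n). (\<Sum>i<n. (x i)\<^sup>2) < 1}"

text \<open>\<open>Y\<close> is the space obtained by attaching \<open>n\<close>-cells to \<open>X\<close>, where \<open>C\<close> is the set of
  characteristic maps. As a set, \<open>Y\<close> is the disjoint union of \<open>X\<close> and the open cells, and
  \<open>Y\<close> carries the quotient topology from the disjoint union of \<open>X\<close> and one closed disc for
  each element of \<open>C\<close>. For \<open>n = 0\<close> the disc is a point with empty boundary.\<close>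

definition attaches_cells ::
    "nat \<Rightarrow> 'a topology \<Rightarrow> 'a topology \<Rightarrow> ((nat \<Rightarrow> real) \<Rightarrow> 'a) set \<Rightarrow> bool"
  where "attaches_cells n X Y C \<longleftrightarrow>
    topspace X \<subseteq> topspace Y \<and>
    (\<forall>c\<in>C. continuous_map (subtopology (disc n) (disc_boundary n)) X c) \<and>
    bij_betw (\<lambda>(c, v). c v) (C \<times> disc_interior n) (topspace Y - topspace X) \<and>
    (\<forall>T. openin Y T \<longleftrightarrow> T \<subseteq> topspace Y \<and> openin X (T \<inter> topspace X) \<and>
           (\<forall>c\<in>C. openin (disc n) {v \<in> topspace (disc n). c v \<in> T}))"

primrec CW_complex_below :: "nat \<Rightarrow> 'a topology \<Rightarrow> bool"
  where
    "CW_complex_below 0 X \<longleftrightarrow> topspace X = {}"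
  | "CW_complex_below (Suc n) Y \<longleftrightarrow> (\<exists>X C. CW_complex_below n X \<and> attaches_cells n X Y C)"

text \<open>\<open>CW_complex_below n X\<close> says that \<open>X\<close> admits a CW structure whose cells all have dimension
  less than \<open>n\<close>. Dimension exactly \<open>m\<close> requires in addition at least one \<open>m\<close>-cell.\<close>

definition CW_complex_dim :: "nat \<Rightarrow> 'a topology \<Rightarrow> bool"
  where "CW_complex_dim m Y \<longleftrightarrow>
    (\<exists>X C. CW_complex_below m X \<and> attaches_cells m X Y C \<and> C \<noteq> {})"

section \<open>Sectional category\<close>

definition maps_lift ::
    "'a topology \<Rightarrow> 'e topology \<Rightarrow> 'b topology \<Rightarrow> ('e \<Rightarrow> 'b) \<Rightarrow> 'b set \<Rightarrow> bool"
  where "maps_lift P E B p U \<longleftrightarrow>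
    (\<forall>\<phi>. continuous_map P (subtopology B U) \<phi> \<longrightarrow>
       (\<exists>s. continuous_map P E s \<and> (\<forall>x\<in>topspace P. p (s x) = \<phi> x)))"

text \<open>As for fibrations, "every \<open>m\<close>-dimensional CW complex \<open>P\<close>" has to be expressed by complexes
  with points in one type. The following datatype is large enough for maps into spaces over
  \<open>'b\<close>. Theorem \<open>m_liftable_maps_lift\<close> below shows that complexes over every other type are
  then covered as well. The point \<open>Cell n a b v\<close> is intended as the point \<open>v\<close> of an \<open>n\<close>-cell
  attached along \<open>a\<close> and mapped to \<open>'b\<close> by \<open>b\<close>. The constructor \<open>Base\<close> only makes the datatype
  nonempty.\<close>

datatype 'b cell_point =
    Base
  | Cell nat "(nat \<Rightarrow> real) \<Rightarrow> 'b cell_point" "(nat \<Rightarrow> real) \<Rightarrow> 'b" "nat \<Rightarrow> real"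

definition m_liftable ::
    "nat \<Rightarrow> 'e topology \<Rightarrow> 'b topology \<Rightarrow> ('e \<Rightarrow> 'b) \<Rightarrow> 'b set \<Rightarrow> bool"
  where "m_liftable m E B p U \<longleftrightarrow>
    (\<forall>P :: 'b cell_point topology. CW_complex_dim m P \<longrightarrow> maps_lift P E B p U)"

definition secat :: "nat \<Rightarrow> 'e topology \<Rightarrow> 'b topology \<Rightarrow> ('e \<Rightarrow> 'b) \<Rightarrow> enat"
  where "secat m E B p =
    Inf {enat k | k. \<exists>U :: nat \<Rightarrow> 'b set.
           (\<forall>i\<le>k. openin B (U i)) \<and> (\<Union>i\<le>k. U i) = topspace B \<and>
           (\<forall>i\<le>k. m_liftable m E B p (U i))}"

primrec cell_value :: "'b cell_point \<Rightarrow> 'b"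
  where
    "cell_value Base = undefined"
  | "cell_value (Cell n a b v) = b v"

primrec cell_dim :: "'b cell_point \<Rightarrow> nat"
  where
    "cell_dim Base = 0"
  | "cell_dim (Cell n a b v) = n"

definition cell_map ::
    "nat \<Rightarrow> ((nat \<Rightarrow> real) \<Rightarrow> 'b cell_point) \<Rightarrow> ((nat \<Rightarrow> real) \<Rightarrow> 'b) \<Rightarrow> (nat \<Rightarrow> real) \<Rightarrow> 'b cell_point"
  where "cell_map n a b v = (if v \<in> disc_interior n then Cell n a b v else a v)"

definition cell_data ::
    "nat \<Rightarrow> 'b topology \<Rightarrow> 'b cell_point topology \<Rightarrow>
      (((nat \<Rightarrow> real) \<Rightarrow> 'b cell_point) \<times> ((nat \<Rightarrow> real) \<Rightarrow> 'b)) set"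
  where "cell_data n W Q = {(a, b).
    continuous_map (subtopology (disc n) (disc_boundary n)) Q a \<and>
    continuous_map (disc n) W b \<and> (\<forall>v\<in>disc_boundary n. cell_value (a v) = b v)}"

lemma topspace_disc_split:
  "topspace (disc n) = disc_interior n \<union> disc_boundary n"
  "disc_interior n \<inter> disc_boundary n = {}"
  "disc_interior n \<subseteq> topspace (disc n)" "disc_boundary n \<subseteq> topspace (disc n)"
  unfolding disc_interior_def disc_boundary_def
  by (auto simp: disc_def topspace_subtopology)

lemma disc_interior_nonempty: "disc_interior n \<noteq> {}"
proof -
  have "(\<lambda>_. 0) \<in> disc_interior n"
    by (simp add: disc_interior_def disc_def topspace_subtopology topspace_Euclidean_space)
  then show ?thesis by blast
qed

text \<open>One step of the construction of a complex \<open>Q\<close> over \<open>W\<close> through which all maps from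
  complexes of a given dimension to \<open>W\<close> factor: attach a cell for every possible pair of an
  attaching map and a compatible map of the disc to \<open>W\<close>.\<close>

lemma exists_universal_attachment:
  fixes W :: "'b topology" and Q :: "'b cell_point topology"
  assumes dim: "\<And>z. z \<in> topspace Q \<Longrightarrow> cell_dim z < n"
    and val: "continuous_map Q W cell_value"
  shows "\<exists>R. attaches_cells n Q R ((\<lambda>(a, b). cell_map n a b) ` cell_data n W Q) \<and>
             (\<forall>z\<in>topspace R. cell_dim z < Suc n) \<and> continuous_map R W cell_value"
proof -
  define K where "K = cell_data n W Q"
  define C where "C = (\<lambda>(a, b). cell_map n a b) ` K"
  define N where "N = {Cell n a b v | a b v. (a, b) \<in> K \<and> v \<in> disc_interior n}"
  define op where "op = (\<lambda>T. T \<subseteq> topspace Q \<union> N \<and> openin Q (T \<inter> topspace Q) \<and>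
           (\<forall>c\<in>C. openin (disc n) {v \<in> topspace (disc n). c v \<in> T}))"
  have disj: "topspace Q \<inter> N = {}"
    using dim by (force simp: N_def)
  have bdry: "cell_map n a b v = a v" "a v \<in> topspace Q"
    if "(a, b) \<in> K" "v \<in> disc_boundary n" for a b v
  proof -
    show "cell_map n a b v = a v"
      using that topspace_disc_split(2)[of n] by (auto simp: cell_map_def)
    have "v \<in> topspace (subtopology (disc n) (disc_boundary n))"
      using that topspace_disc_split(4)[of n] by (auto simp: topspace_subtopology)
    moreover have "continuous_map (subtopology (disc n) (disc_boundary n)) Q a"
      using that by (auto simp: K_def cell_data_def)
    ultimately show "a v \<in> topspace Q"
      by (rule continuous_map_in_topspace[rotated])
  qed
  have intr: "cell_map n a b v = Cell n a b v" if "v \<in> disc_interior n" for a b v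
    using that by (simp add: cell_map_def)
  have ist: "istopology op"
    unfolding istopology_def
  proof (intro conjI allI impI)
    fix S T assume ST: "op S" "op T"
    have "openin Q (S \<inter> T \<inter> topspace Q)"
    proof -
      have "S \<inter> T \<inter> topspace Q = (S \<inter> topspace Q) \<inter> (T \<inter> topspace Q)" by auto
      then show ?thesis using ST by (auto simp: op_def)
    qed
    moreover have "openin (disc n) {v \<in> topspace (disc n). c v \<in> S \<inter> T}" if "c \<in> C" for c
    proof -
      have "{v \<in> topspace (disc n). c v \<in> S \<inter> T} =
            {v \<in> topspace (disc n). c v \<in> S} \<inter> {v \<in> topspace (disc n). c v \<in> T}" by auto
      then show ?thesis using ST that by (auto simp: op_def)
    qed
    ultimately show "op (S \<inter> T)"
      using ST by (auto simp: op_def)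
  next
    fix F assume F: "\<forall>T\<in>F. op T"
    have "openin Q (\<Union>F \<inter> topspace Q)"
    proof -
      have "\<Union>F \<inter> topspace Q = (\<Union>T\<in>F. T \<inter> topspace Q)" by auto
      moreover have "openin Q (\<Union>T\<in>F. T \<inter> topspace Q)"
        by (intro openin_Union) (use F in \<open>auto simp: op_def\<close>)
      ultimately show ?thesis by simp
    qed
    moreover have "openin (disc n) {v \<in> topspace (disc n). c v \<in> \<Union>F}" if "c \<in> C" for c
    proof -
      have "{v \<in> topspace (disc n). c v \<in> \<Union>F} =
            (\<Union>T\<in>F. {v \<in> topspace (disc n). c v \<in> T})" by auto
      moreover have "openin (disc n) (\<Union>T\<in>F. {v \<in> topspace (disc n). c v \<in> T})"
        by (intro openin_Union) (use F that in \<open>auto simp: op_def\<close>)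
      ultimately show ?thesis by simp
    qed
    ultimately show "op (\<Union>F)"
      using F by (auto simp: op_def)
  qed
  define R where "R = topology op"
  have op: "openin R T \<longleftrightarrow> op T" for T
    using ist by (simp add: R_def topology_inverse')
  have Cim: "c v \<in> topspace Q \<union> N" if "c \<in> C" "v \<in> topspace (disc n)" for c v
  proof -
    obtain a b where ab: "(a, b) \<in> K" "c = cell_map n a b"
      using \<open>c \<in> C\<close> by (auto simp: C_def)
    show ?thesis
      using that ab bdry[OF ab(1)] intr[of v a b] topspace_disc_split(1)[of n]
      by (auto simp: N_def)
  qed
  have "op (topspace Q \<union> N)"
  proof -
    have "(topspace Q \<union> N) \<inter> topspace Q = topspace Q" by auto
    moreover have "{v \<in> topspace (disc n). c v \<in> topspace Q \<union> N} = topspace (disc n)"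
      if "c \<in> C" for c using Cim[OF that] by auto
    ultimately show ?thesis by (simp add: op_def)
  qed
  then have "topspace Q \<union> N \<subseteq> topspace R"
    unfolding op[symmetric] by (rule openin_subset)
  moreover have "op (topspace R)" by (simp flip: op)
  ultimately have top: "topspace R = topspace Q \<union> N"
    unfolding op_def by blast
  have "attaches_cells n Q R C"
    unfolding attaches_cells_def
  proof (intro conjI ballI allI)
    show "topspace Q \<subseteq> topspace R" by (simp add: top)
  next
    fix c assume "c \<in> C"
    then obtain a b where ab: "(a, b) \<in> K" "c = cell_map n a b"
      by (auto simp: C_def)
    have "continuous_map (subtopology (disc n) (disc_boundary n)) Q a"
      using ab by (auto simp: K_def cell_data_def)
    then show "continuous_map (subtopology (disc n) (disc_boundary n)) Q c"
      by (rule continuous_map_eq) (use ab bdry in auto)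
  next
    have "inj_on (\<lambda>(c, v). c v) (C \<times> disc_interior n)"
      by (rule inj_onI) (auto simp: C_def intr)
    moreover have "(\<lambda>(c, v). c v) ` (C \<times> disc_interior n) = topspace R - topspace Q"
    proof -
      have "(\<lambda>(c, v). c v) ` (C \<times> disc_interior n) = N"
      proof
        show "(\<lambda>(c, v). c v) ` (C \<times> disc_interior n) \<subseteq> N"
          by (auto simp: C_def intr N_def)
        show "N \<subseteq> (\<lambda>(c, v). c v) ` (C \<times> disc_interior n)"
        proof
          fix z assume "z \<in> N"
          then obtain a b v where z: "z = Cell n a b v" "(a, b) \<in> K" "v \<in> disc_interior n"
            by (auto simp: N_def)
          then have "z = (\<lambda>(c, v). c v) (cell_map n a b, v)" by (simp add: intr)
          moreover have "(cell_map n a b, v) \<in> C \<times> disc_interior n"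
            using z by (auto simp: C_def)
          ultimately show "z \<in> (\<lambda>(c, v). c v) ` (C \<times> disc_interior n)" by blast
        qed
      qed
      then show ?thesis using disj by (auto simp: top)
    qed
    ultimately show "bij_betw (\<lambda>(c, v). c v) (C \<times> disc_interior n) (topspace R - topspace Q)"
      by (simp add: bij_betw_def)
  next
    fix T show "openin R T \<longleftrightarrow> T \<subseteq> topspace R \<and> openin Q (T \<inter> topspace Q) \<and>
           (\<forall>c\<in>C. openin (disc n) {v \<in> topspace (disc n). c v \<in> T})"
      by (simp add: op op_def top)
  qed
  moreover have "\<forall>z\<in>topspace R. cell_dim z < Suc n"
    using dim by (fastforce simp: top N_def)
  moreover have "continuous_map R W cell_value"
    unfolding continuous_map_def
  proof (intro conjI allI impI)
    have "cell_value z \<in> topspace W" if "z \<in> topspace R" for z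
      using that unfolding top
    proof
      assume "z \<in> topspace Q"
      then show ?thesis using continuous_map_image_subset_topspace[OF val] by blast
    next
      assume "z \<in> N"
      then obtain a b v where z: "z = Cell n a b v" "(a, b) \<in> K" "v \<in> disc_interior n"
        by (auto simp: N_def)
      then have "continuous_map (disc n) W b" by (auto simp: K_def cell_data_def)
      moreover have "v \<in> topspace (disc n)" using z topspace_disc_split(3) by blast
      ultimately show ?thesis using z
        by (simp add: continuous_map_in_topspace)
    qed
    then show "cell_value \<in> topspace R \<rightarrow> topspace W" by auto
  next
    fix T assume T: "openin W T"
    let ?S = "{z \<in> topspace R. cell_value z \<in> T}"
    have "?S \<inter> topspace Q = {z \<in> topspace Q. cell_value z \<in> T}" by (auto simp: top)
    then have "openin Q (?S \<inter> topspace Q)"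
      using val T by (simp add: openin_continuous_map_preimage)
    moreover have "openin (disc n) {v \<in> topspace (disc n). c v \<in> ?S}" if "c \<in> C" for c
    proof -
      obtain a b where ab: "(a, b) \<in> K" "c = cell_map n a b"
        using \<open>c \<in> C\<close> by (auto simp: C_def)
      then have b: "continuous_map (disc n) W b"
        and eq: "\<forall>v\<in>disc_boundary n. cell_value (a v) = b v"
        by (auto simp: K_def cell_data_def)
      have "cell_value (c v) = b v" if "v \<in> topspace (disc n)" for v
        using that ab(2) eq topspace_disc_split(1)[of n] by (auto simp: cell_map_def)
      then have "{v \<in> topspace (disc n). c v \<in> ?S} = {v \<in> topspace (disc n). b v \<in> T}"
        using Cim[OF \<open>c \<in> C\<close>] by (auto simp: top)
      then show ?thesis using b T by (simp add: openin_continuous_map_preimage)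
    qed
    ultimately show "openin R ?S"
      unfolding op op_def by (auto simp: top)
  qed
  ultimately show ?thesis
    unfolding C_def K_def by blast
qed

lemma factor_through_attachment:
  fixes W :: "'b topology" and Q R :: "'b cell_point topology" and X Y :: "'a topology"
  assumes XY: "attaches_cells n X Y D"
    and QR: "attaches_cells n Q R ((\<lambda>(a, b). cell_map n a b) ` cell_data n W Q)"
    and phi: "continuous_map Y W \<phi>"
    and r: "continuous_map X Q r" "\<forall>x\<in>topspace X. cell_value (r x) = \<phi> x"
  shows "(\<exists>s. continuous_map Y R s \<and> (\<forall>y\<in>topspace Y. cell_value (s y) = \<phi> y)) \<and>
         (D \<noteq> {} \<longrightarrow> cell_data n W Q \<noteq> {})"
proof -
  have sub: "topspace X \<subseteq> topspace Y"
    and att: "\<And>c. c \<in> D \<Longrightarrow> continuous_map (subtopology (disc n) (disc_boundary n)) X c"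
    and bij: "bij_betw (\<lambda>(c, v). c v) (D \<times> disc_interior n) (topspace Y - topspace X)"
    and opY: "\<And>T. openin Y T \<longleftrightarrow> T \<subseteq> topspace Y \<and> openin X (T \<inter> topspace X) \<and>
           (\<forall>c\<in>D. openin (disc n) {v \<in> topspace (disc n). c v \<in> T})"
    using XY unfolding attaches_cells_def by auto
  have subQ: "topspace Q \<subseteq> topspace R"
    and bijR: "bij_betw (\<lambda>(c, v). c v) (((\<lambda>(a, b). cell_map n a b) ` cell_data n W Q) \<times> disc_interior n)
                 (topspace R - topspace Q)"
    and opR: "\<And>T. openin R T \<longleftrightarrow> T \<subseteq> topspace R \<and> openin Q (T \<inter> topspace Q) \<and>
           (\<forall>c\<in>(\<lambda>(a, b). cell_map n a b) ` cell_data n W Q.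
               openin (disc n) {v \<in> topspace (disc n). c v \<in> T})"
    using QR unfolding attaches_cells_def by auto
  have bd: "c v \<in> topspace X" if "c \<in> D" "v \<in> disc_boundary n" for c v
  proof -
    have "v \<in> topspace (subtopology (disc n) (disc_boundary n))"
      using that topspace_disc_split(4)[of n] by (auto simp: topspace_subtopology)
    then show ?thesis by (rule continuous_map_in_topspace[OF att[OF \<open>c \<in> D\<close>]])
  qed
  have int: "c v \<in> topspace Y - topspace X" if "c \<in> D" "v \<in> disc_interior n" for c v
    using bij_betwE[OF bij] that by force
  have cY: "continuous_map (disc n) Y c" if "c \<in> D" for c
    unfolding continuous_map_def
  proof (intro conjI allI impI)
    show "c \<in> topspace (disc n) \<rightarrow> topspace Y"
      using bd[OF that] int[OF that] sub topspace_disc_split(1)[of n] by auto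
    fix T assume "openin Y T"
    then show "openin (disc n) {v \<in> topspace (disc n). c v \<in> T}" using opY that by blast
  qed
  have data: "(r \<circ> c, \<phi> \<circ> c) \<in> cell_data n W Q" if "c \<in> D" for c
    unfolding cell_data_def
    using continuous_map_compose[OF att[OF that] r(1)] continuous_map_compose[OF cY[OF that] phi]
      r(2) bd[OF that] by auto
  define g where "g = inv_into (D \<times> disc_interior n) (\<lambda>(c, v). c v)"
  define s where "s = (\<lambda>y. if y \<in> topspace X then r y
       else (case g y of (c, v) \<Rightarrow> Cell n (r \<circ> c) (\<phi> \<circ> c) v))"
  have g: "g (c v) = (c, v)" if "c \<in> D" "v \<in> disc_interior n" for c v
  proof -
    have "inj_on (\<lambda>(c, v). c v) (D \<times> disc_interior n)"
      using bij by (simp add: bij_betw_def)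
    from inv_into_f_f[OF this, of "(c, v)"] that show ?thesis by (simp add: g_def)
  qed
  have sX: "s y = r y" if "y \<in> topspace X" for y
    using that by (simp add: s_def)
  have sc: "s (c v) = cell_map n (r \<circ> c) (\<phi> \<circ> c) v" if "c \<in> D" "v \<in> topspace (disc n)" for c v
  proof (cases "v \<in> disc_interior n")
    case True
    then show ?thesis using int[OF that(1) True] g[OF that(1) True]
      by (simp add: s_def cell_map_def)
  next
    case False
    then have "v \<in> disc_boundary n" using that topspace_disc_split(1)[of n] by auto
    then show ?thesis using False sX bd[OF that(1)] by (simp add: cell_map_def)
  qed
  have cover: "\<exists>c\<in>D. \<exists>v\<in>disc_interior n. y = c v" if "y \<in> topspace Y" "y \<notin> topspace X" for y
  proof -
    have "y \<in> (\<lambda>(c, v). c v) ` (D \<times> disc_interior n)"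
      using bij that by (simp add: bij_betw_def)
    then show ?thesis by auto
  qed
  have rim: "r x \<in> topspace Q" if "x \<in> topspace X" for x
    using continuous_map_in_topspace[OF r(1) that] .
  have sR: "s y \<in> topspace R" if y: "y \<in> topspace Y" for y
  proof (cases "y \<in> topspace X")
    case True then show ?thesis using sX rim subQ by auto
  next
    case False
    then obtain c v where cv: "c \<in> D" "v \<in> disc_interior n" "y = c v" using cover y by blast
    have "cell_map n (r \<circ> c) (\<phi> \<circ> c) \<in> (\<lambda>(a, b). cell_map n a b) ` cell_data n W Q"
      using data[OF cv(1)] by force
    then have "cell_map n (r \<circ> c) (\<phi> \<circ> c) v \<in> topspace R"
      using bij_betwE[OF bijR, rule_format, of "(cell_map n (r \<circ> c) (\<phi> \<circ> c), v)"] cv(2) by simp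
    moreover have "v \<in> topspace (disc n)" using cv(2) topspace_disc_split(3) by blast
    ultimately show ?thesis using sc[OF cv(1)] cv(3) by simp
  qed
  have "continuous_map Y R s"
    unfolding continuous_map_def
  proof (intro conjI allI impI)
    show "s \<in> topspace Y \<rightarrow> topspace R" using sR by auto
    fix T assume T: "openin R T"
    have X: "{y \<in> topspace Y. s y \<in> T} \<inter> topspace X = {x \<in> topspace X. r x \<in> T \<inter> topspace Q}"
      using sub sX rim by auto
    have oX: "openin X {x \<in> topspace X. r x \<in> T \<inter> topspace Q}"
    proof (rule openin_continuous_map_preimage[OF r(1)])
      show "openin Q (T \<inter> topspace Q)" using T opR[of T] by simp
    qed
    have oD: "openin (disc n) {v \<in> topspace (disc n). c v \<in> {y \<in> topspace Y. s y \<in> T}}"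
      if "c \<in> D" for c
    proof -
      have "c v \<in> topspace Y" if "v \<in> topspace (disc n)" for v
        using continuous_map_in_topspace[OF cY[OF \<open>c \<in> D\<close>] that] .
      then have "{v \<in> topspace (disc n). c v \<in> {y \<in> topspace Y. s y \<in> T}} =
            {v \<in> topspace (disc n). cell_map n (r \<circ> c) (\<phi> \<circ> c) v \<in> T}"
        using sc[OF that] by auto
      moreover have "cell_map n (r \<circ> c) (\<phi> \<circ> c) \<in> (\<lambda>(a, b). cell_map n a b) ` cell_data n W Q"
        using data[OF that] by force
      then have "openin (disc n) {v \<in> topspace (disc n). cell_map n (r \<circ> c) (\<phi> \<circ> c) v \<in> T}"
        using T unfolding opR[of T] by blast
      ultimately show ?thesis by (simp only:)
    qed
    show "openin Y {y \<in> topspace Y. s y \<in> T}"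
      unfolding opY[of "{y \<in> topspace Y. s y \<in> T}"] X using oX oD by blast
  qed
  moreover have "cell_value (s y) = \<phi> y" if y: "y \<in> topspace Y" for y
  proof (cases "y \<in> topspace X")
    case True then show ?thesis using sX r(2) by auto
  next
    case False
    then obtain c v where cv: "c \<in> D" "v \<in> disc_interior n" "y = c v" using cover y by blast
    then show ?thesis using sc[OF cv(1), of v] topspace_disc_split(3)[of n]
      by (auto simp: cell_map_def)
  qed
  moreover have "cell_data n W Q \<noteq> {}" if "D \<noteq> {}"
    using data that by fastforce
  ultimately show ?thesis by (intro conjI exI[of _ s]) auto
qed

lemma attaches_cells_continuous:
  assumes "attaches_cells n X Y C" "continuous_map Y W \<phi>"
  shows "continuous_map X W \<phi>"
proof -
  have sub: "topspace X \<subseteq> topspace Y"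
    and opY: "\<And>T. openin Y T \<Longrightarrow> openin X (T \<inter> topspace X)"
    using assms(1) unfolding attaches_cells_def by auto
  have "continuous_map X Y id"
    unfolding continuous_map_def
  proof (intro conjI allI impI)
    show "id \<in> topspace X \<rightarrow> topspace Y" using sub by auto
    fix T assume "openin Y T"
    moreover have "{x \<in> topspace X. id x \<in> T} = T \<inter> topspace X" by auto
    ultimately show "openin X {x \<in> topspace X. id x \<in> T}" using opY by simp
  qed
  from continuous_map_compose[OF this assms(2)] show ?thesis by simp
qed

lemma exists_universal_complex:
  fixes W :: "'b topology"
  shows "\<exists>Q :: 'b cell_point topology. CW_complex_below n Q \<and>
           (\<forall>z\<in>topspace Q. cell_dim z < n) \<and> continuous_map Q W cell_value \<and>
           (\<forall>(P :: 'a topology) \<phi>. CW_complex_below n P \<longrightarrow> continuous_map P W \<phi> \<longrightarrow>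
              (\<exists>r. continuous_map P Q r \<and> (\<forall>x\<in>topspace P. cell_value (r x) = \<phi> x)))"
proof (induction n)
  case 0
  have "CW_complex_below 0 (discrete_topology {} :: 'b cell_point topology)" by simp
  then show ?case
    by (intro exI[of _ "discrete_topology {}"]) (auto simp: continuous_map_def)
next
  case (Suc n)
  then obtain Q :: "'b cell_point topology" where Q: "CW_complex_below n Q"
      "\<And>z. z \<in> topspace Q \<Longrightarrow> cell_dim z < n" "continuous_map Q W cell_value"
      "\<And>(P :: 'a topology) \<phi>. CW_complex_below n P \<Longrightarrow> continuous_map P W \<phi> \<Longrightarrow>
              (\<exists>r. continuous_map P Q r \<and> (\<forall>x\<in>topspace P. cell_value (r x) = \<phi> x))"
    by blast
  obtain R where R: "attaches_cells n Q R ((\<lambda>(a, b). cell_map n a b) ` cell_data n W Q)"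
      "\<forall>z\<in>topspace R. cell_dim z < Suc n" "continuous_map R W cell_value"
    using exists_universal_attachment[OF Q(2,3)] by blast
  have "\<exists>r. continuous_map P R r \<and> (\<forall>x\<in>topspace P. cell_value (r x) = \<phi> x)"
    if P: "CW_complex_below (Suc n) P" and phi: "continuous_map P W \<phi>" for P :: "'a topology" and \<phi>
  proof -
    obtain X D where X: "CW_complex_below n X" "attaches_cells n X P D" using P by auto
    have "continuous_map X W \<phi>"
      using attaches_cells_continuous[OF X(2) phi] .
    then obtain r where "continuous_map X Q r" "\<forall>x\<in>topspace X. cell_value (r x) = \<phi> x"
      using Q(4)[OF X(1)] by blast
    then show ?thesis using factor_through_attachment[OF X(2) R(1) phi] by blast
  qed
  moreover have "CW_complex_below (Suc n) R" using Q(1) R(1) by auto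
  ultimately show ?case using R(2,3) by blast
qed

theorem m_liftable_maps_lift:
  fixes P :: "'a topology" and E :: "'e topology" and B :: "'b topology"
  assumes lift: "m_liftable m E B p U" and P: "CW_complex_dim m P"
  shows "maps_lift P E B p U"
  unfolding maps_lift_def
proof (intro allI impI)
  fix \<phi> assume phi: "continuous_map P (subtopology B U) \<phi>"
  let ?W = "subtopology B U"
  obtain X D where X: "CW_complex_below m X" "attaches_cells m X P D" "D \<noteq> {}"
    using P unfolding CW_complex_dim_def by blast
  obtain Q :: "'b cell_point topology" where Q': "CW_complex_below m Q \<and>
           (\<forall>z\<in>topspace Q. cell_dim z < m) \<and> continuous_map Q ?W cell_value \<and>
           (\<forall>(P :: 'a topology) \<phi>. CW_complex_below m P \<longrightarrow> continuous_map P ?W \<phi> \<longrightarrow>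
              (\<exists>r. continuous_map P Q r \<and> (\<forall>x\<in>topspace P. cell_value (r x) = \<phi> x)))"
    using exists_universal_complex[where ?'a = 'a and n = m and W = ?W] by (rule exE)
  then have Q: "CW_complex_below m Q" "\<And>z. z \<in> topspace Q \<Longrightarrow> cell_dim z < m"
      "continuous_map Q ?W cell_value"
    by auto
  obtain R where R: "attaches_cells m Q R ((\<lambda>(a, b). cell_map m a b) ` cell_data m ?W Q)"
      "continuous_map R ?W cell_value"
    using exists_universal_attachment[OF Q(2,3)] by blast
  obtain r where r: "continuous_map X Q r" "\<forall>x\<in>topspace X. cell_value (r x) = \<phi> x"
    using Q'[THEN conjunct2, THEN conjunct2, THEN conjunct2, rule_format,
        OF X(1) attaches_cells_continuous[OF X(2) phi]] by blast
  obtain f where f: "continuous_map P R f" "\<forall>x\<in>topspace P. cell_value (f x) = \<phi> x"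
    and ne: "cell_data m ?W Q \<noteq> {}"
    using factor_through_attachment[OF X(2) R(1) phi r] X(3) by auto
  have "CW_complex_dim m R"
    unfolding CW_complex_dim_def using Q(1) R(1) ne by blast
  then obtain s where s: "continuous_map R E s" "\<forall>z\<in>topspace R. p (s z) = cell_value z"
    using lift[unfolded m_liftable_def maps_lift_def, rule_format, OF _ R(2)] by blast
  have "p ((s \<circ> f) x) = \<phi> x" if "x \<in> topspace P" for x
  proof -
    have "f x \<in> topspace R"
      using continuous_map_in_topspace[OF f(1) that] .
    then show ?thesis using s(2) f(2) that by simp
  qed
  then show "\<exists>s. continuous_map P E s \<and> (\<forall>x\<in>topspace P. p (s x) = \<phi> x)"
    using continuous_map_compose[OF f(1) s(1)] by blast
qed

section \<open>Homotopy inverses and fibre-preserving homotopy equivalence\<close>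

definition right_homotopy_inverse ::
    "'a topology \<Rightarrow> 'b topology \<Rightarrow> ('a \<Rightarrow> 'b) \<Rightarrow> ('b \<Rightarrow> 'a) \<Rightarrow> bool"
  where "right_homotopy_inverse X Y f g \<longleftrightarrow>
    continuous_map Y X g \<and> homotopic_with (\<lambda>_. True) Y Y (f \<circ> g) id"

definition homotopy_equivalence_map :: "'a topology \<Rightarrow> 'b topology \<Rightarrow> ('a \<Rightarrow> 'b) \<Rightarrow> bool"
  where "homotopy_equivalence_map X Y f \<longleftrightarrow>
    continuous_map X Y f \<and>
    (\<exists>g. continuous_map Y X g \<and>
         homotopic_with (\<lambda>_. True) Y Y (f \<circ> g) id \<and>
         homotopic_with (\<lambda>_. True) X X (g \<circ> f) id)"

definition fibre_preserving_map ::
    "'e topology \<Rightarrow> 'b topology \<Rightarrow> ('e \<Rightarrow> 'b) \<Rightarrow> 'f topology \<Rightarrow> 'c topology \<Rightarrow> ('f \<Rightarrow> 'c) \<Rightarrow>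
      ('e \<Rightarrow> 'f) \<Rightarrow> ('b \<Rightarrow> 'c) \<Rightarrow> bool"
  where "fibre_preserving_map E B p E' B' p' f g \<longleftrightarrow>
    continuous_map E E' f \<and> continuous_map B B' g \<and> (\<forall>x\<in>topspace E. p' (f x) = g (p x))"

definition fibre_preserving_homotopic ::
    "'e topology \<Rightarrow> 'b topology \<Rightarrow> ('e \<Rightarrow> 'b) \<Rightarrow> 'f topology \<Rightarrow> 'c topology \<Rightarrow> ('f \<Rightarrow> 'c) \<Rightarrow>
      ('e \<Rightarrow> 'f) \<times> ('b \<Rightarrow> 'c) \<Rightarrow> ('e \<Rightarrow> 'f) \<times> ('b \<Rightarrow> 'c) \<Rightarrow> bool"
  where "fibre_preserving_homotopic E B p E' B' p' = (\<lambda>(f0, g0) (f1, g1).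
    \<exists>F G. continuous_map (cylinder E) E' F \<and> continuous_map (cylinder B) B' G \<and>
      (\<forall>t\<in>{0..1}. \<forall>x\<in>topspace E. p' (F (t, x)) = G (t, p x)) \<and>
      (\<forall>x\<in>topspace E. F (0, x) = f0 x \<and> F (1, x) = f1 x) \<and>
      (\<forall>y\<in>topspace B. G (0, y) = g0 y \<and> G (1, y) = g1 y))"

definition fibre_preserving_homotopy_equivalent ::
    "'e topology \<Rightarrow> 'b topology \<Rightarrow> ('e \<Rightarrow> 'b) \<Rightarrow> 'f topology \<Rightarrow> 'c topology \<Rightarrow> ('f \<Rightarrow> 'c) \<Rightarrow> bool"
  where "fibre_preserving_homotopy_equivalent E B p E' B' p' \<longleftrightarrow>
    (\<exists>f g f' g'. fibre_preserving_map E B p E' B' p' f g \<and>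
       fibre_preserving_map E' B' p' E B p f' g' \<and>
       fibre_preserving_homotopic E' B' p' E' B' p' (f \<circ> f', g \<circ> g') (id, id) \<and>
       fibre_preserving_homotopic E B p E B p (f' \<circ> f, g' \<circ> g) (id, id))"

end

theory Submission
  imports Defs
begin

text \<open>
  Everything rests on one comparison. Suppose that \<open>f' : E' \<rightarrow> E\<close> covers \<open>f : B' \<rightarrow> B\<close> up to
  homotopy and that \<open>f \<circ> g \<simeq> id\<close>. Pull an open cover of \<open>B'\<close> back along \<open>g\<close>. A map \<open>\<phi>\<close>
  from a complex into \<open>g\<inverse>(U)\<close> gives a map \<open>g \<circ> \<phi>\<close> into \<open>U\<close>, which has a lift \<open>s\<close> through
  \<open>p'\<close>, and then \<open>p \<circ> (f' \<circ> s) \<simeq> f \<circ> p' \<circ> s = f \<circ> g \<circ> \<phi> \<simeq> \<phi>\<close>. So \<open>\<phi>\<close> lifts through \<open>p\<close> up to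
  homotopy, and the homotopy lifting property of \<open>p\<close> makes the lift strict
  (\<open>fibration_strictify_lift\<close>). Hence every cover of \<open>B'\<close> that counts for \<open>p'\<close> yields one of the
  same size that counts for \<open>p\<close> (\<open>secat_le_of_homotopy_square\<close>).

  For the equality, let \<open>g\<close> be a homotopy inverse of \<open>f\<close> and \<open>g'\<close> a right homotopy inverse of
  \<open>f'\<close>. Then \<open>g'\<close> covers \<open>g\<close> up to homotopy (\<open>homotopy_square_reverse\<close>), so the comparison
  applies in the opposite direction. A fibre-preserving homotopy equivalence provides strictly
  commuting squares in both directions whose base maps are mutually inverse up to homotopy, so
  the comparison applies twice.
\<close>

text \<open>The endpoint of a lifted homotopy is a strict lift. The homotopy is lifted from its
  time \<open>0\<close>, where the lift \<open>t\<close> is given.\<close>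

lemma fibration_strictify_lift:
  assumes fib: "fibration E B p" and t: "continuous_map X E t"
    and hom: "homotopic_with (\<lambda>_. True) X B (p \<circ> t) \<phi>"
  shows "\<exists>s. continuous_map X E s \<and> (\<forall>x\<in>topspace X. p (s x) = \<phi> x)"
proof -
  obtain h where h: "continuous_map (cylinder X) B h"
      "\<And>x. h (0, x) = p (t x)" "\<And>x. h (1, x) = \<phi> x"
    using hom unfolding homotopic_with_def by auto
  obtain H where H: "continuous_map (cylinder X) E H"
      "\<forall>z\<in>topspace (cylinder X). p (H z) = h z"
    using fibration_homotopy_lifting[OF fib, of X, unfolded homotopy_lifting_def, rule_format, of h t]
      h(1,2) t by auto
  have "continuous_map X (cylinder X) (\<lambda>x. (1, x))"
    by (simp add: continuous_map_pairwise o_def)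
  from continuous_map_compose[OF this H(1)] have "continuous_map X E (\<lambda>x. H (1, x))"
    by (simp add: o_def)
  moreover have "\<forall>x\<in>topspace X. p (H (1, x)) = \<phi> x"
    using H(2) h(3) by simp
  ultimately show ?thesis by blast
qed

lemma secat_le_of_cover_transfer:
  assumes "\<And>(k::nat) U. \<lbrakk>\<forall>i\<le>k. openin B' (U i); (\<Union>i\<le>k. U i) = topspace B';
              \<forall>i\<le>k. m_liftable m E' B' p' (U i)\<rbrakk> \<Longrightarrow>
            \<exists>V. (\<forall>i\<le>k. openin B (V i)) \<and> (\<Union>i\<le>k. V i) = topspace B \<and>
              (\<forall>i\<le>k. m_liftable m E B p (V i))"
  shows "secat m E B p \<le> secat m E' B' p'"
  unfolding secat_def
proof (rule Inf_superset_mono, clarify)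
  fix k :: nat and U
  assume "\<forall>i\<le>k. openin B' (U i)" "(\<Union>i\<le>k. U i) = topspace B'"
    "\<forall>i\<le>k. m_liftable m E' B' p' (U i)"
  from assms[OF this]
  show "\<exists>k'. enat k = enat k' \<and> (\<exists>U. (\<forall>i\<le>k'. openin B (U i)) \<and>
      (\<Union>i\<le>k'. U i) = topspace B \<and> (\<forall>i\<le>k'. m_liftable m E B p (U i)))"
    by (intro exI[of _ k] conjI refl)
qed

text \<open>The local form of the comparison. The complex that tests liftability over \<open>B\<close> has its
  points in a type built from that of \<open>B\<close>, and it is used here as a test complex over \<open>B'\<close>.
  This is legitimate because liftability over \<open>B'\<close> extends to complexes over every type
  (\<open>m_liftable_maps_lift\<close>).\<close>

lemma m_liftable_preimage:
  assumes fib: "fibration E B p"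
    and f: "continuous_map B' B f" and f': "continuous_map E' E f'"
    and square: "homotopic_with (\<lambda>_. True) E' B (p \<circ> f') (f \<circ> p')"
    and inv: "right_homotopy_inverse B' B f g"
    and lift: "m_liftable m E' B' p' U"
  shows "m_liftable m E B p {y \<in> topspace B. g y \<in> U}"
  unfolding m_liftable_def maps_lift_def
proof (intro allI impI)
  fix P :: "'b cell_point topology" and \<phi>
  assume P: "CW_complex_dim m P"
    and "continuous_map P (subtopology B {y \<in> topspace B. g y \<in> U}) \<phi>"
  then have phi: "continuous_map P B \<phi>" and phiU: "\<And>x. x \<in> topspace P \<Longrightarrow> g (\<phi> x) \<in> U"
    by (auto simp: continuous_map_in_subtopology)
  have g: "continuous_map B B' g" and fg: "homotopic_with (\<lambda>_. True) B B (f \<circ> g) id"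
    using inv by (auto simp: right_homotopy_inverse_def)
  have "continuous_map P (subtopology B' U) (g \<circ> \<phi>)"
    using continuous_map_compose[OF phi g] phiU by (auto simp: continuous_map_in_subtopology)
  then obtain s where s: "continuous_map P E' s" "\<forall>x\<in>topspace P. p' (s x) = g (\<phi> x)"
    using m_liftable_maps_lift[OF lift P, unfolded maps_lift_def, rule_format, of "g \<circ> \<phi>"]
    by auto
  have "homotopic_with (\<lambda>_. True) P B (p \<circ> f' \<circ> s) (f \<circ> p' \<circ> s)"
    by (rule homotopic_with_compose_continuous_map_right[OF square s(1)]) simp
  moreover have "homotopic_with (\<lambda>_. True) P B (f \<circ> p' \<circ> s) (f \<circ> g \<circ> \<phi>)"
  proof (rule homotopic_with_equal)
    show "continuous_map P B (f \<circ> p' \<circ> s)"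
      using calculation homotopic_with_imp_continuous_maps by blast
  qed (use s(2) in auto)
  moreover have "homotopic_with (\<lambda>_. True) P B (f \<circ> g \<circ> \<phi>) (id \<circ> \<phi>)"
    by (rule homotopic_with_compose_continuous_map_right[OF fg phi]) simp
  ultimately have "homotopic_with (\<lambda>_. True) P B (p \<circ> (f' \<circ> s)) \<phi>"
    unfolding comp_assoc id_comp by (rule homotopic_with_trans[OF homotopic_with_trans])
  then show "\<exists>s. continuous_map P E s \<and> (\<forall>x\<in>topspace P. p (s x) = \<phi> x)"
    using fibration_strictify_lift[OF fib continuous_map_compose[OF s(1) f']] by blast
qed

lemma secat_le_of_homotopy_square:
  assumes "fibration E B p"
    and "continuous_map B' B f" and "continuous_map E' E f'"
    and "homotopic_with (\<lambda>_. True) E' B (p \<circ> f') (f \<circ> p')"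
    and inv: "right_homotopy_inverse B' B f g"
  shows "secat m E B p \<le> secat m E' B' p'"
proof (rule secat_le_of_cover_transfer)
  fix k :: nat and U
  assume U: "\<forall>i\<le>k. openin B' (U i)" "(\<Union>i\<le>k. U i) = topspace B'"
    and lift: "\<forall>i\<le>k. m_liftable m E' B' p' (U i)"
  have g: "continuous_map B B' g"
    using inv by (simp add: right_homotopy_inverse_def)
  let ?V = "\<lambda>i. {y \<in> topspace B. g y \<in> U i}"
  have "\<forall>i\<le>k. openin B (?V i)"
    using U(1) by (simp add: openin_continuous_map_preimage[OF g])
  moreover have "(\<Union>i\<le>k. ?V i) = topspace B"
    using continuous_map_in_topspace[OF g] by (auto simp flip: U(2))
  moreover have "\<forall>i\<le>k. m_liftable m E B p (?V i)"
    using lift by (simp add: m_liftable_preimage[OF assms])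
  ultimately show "\<exists>V. (\<forall>i\<le>k. openin B (V i)) \<and> (\<Union>i\<le>k. V i) = topspace B \<and>
      (\<forall>i\<le>k. m_liftable m E B p (V i))"
    by (intro exI[of _ ?V] conjI)
qed

text \<open>The chain of homotopies is
  \<open>p' \<circ> g' \<simeq> (g \<circ> f) \<circ> p' \<circ> g' \<simeq> g \<circ> p \<circ> (f' \<circ> g') \<simeq> g \<circ> p\<close>. It uses a left homotopy inverse on the
  base but a right homotopy inverse on the total space.\<close>

lemma homotopy_square_reverse:
  assumes p: "continuous_map E B p" and p': "continuous_map E' B' p'"
    and square: "homotopic_with (\<lambda>_. True) E' B (p \<circ> f') (f \<circ> p')"
    and g: "continuous_map B B' g" and gf: "homotopic_with (\<lambda>_. True) B' B' (g \<circ> f) id"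
    and inv: "right_homotopy_inverse E' E f' g'"
  shows "homotopic_with (\<lambda>_. True) E B' (p' \<circ> g') (g \<circ> p)"
proof -
  have g': "continuous_map E E' g'" and fg': "homotopic_with (\<lambda>_. True) E E (f' \<circ> g') id"
    using inv by (auto simp: right_homotopy_inverse_def)
  have "homotopic_with (\<lambda>_. True) E B' (g \<circ> f \<circ> (p' \<circ> g')) (id \<circ> (p' \<circ> g'))"
    by (rule homotopic_with_compose_continuous_map_right[OF gf continuous_map_compose[OF g' p']])
      simp
  then have 1: "homotopic_with (\<lambda>_. True) E B' (p' \<circ> g') (g \<circ> f \<circ> (p' \<circ> g'))"
    by (simp add: homotopic_with_sym)
  have "homotopic_with (\<lambda>_. True) E B (p \<circ> f' \<circ> g') (f \<circ> p' \<circ> g')"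
    by (rule homotopic_with_compose_continuous_map_right[OF square g']) simp
  then have "homotopic_with (\<lambda>_. True) E B' (g \<circ> (p \<circ> f' \<circ> g')) (g \<circ> (f \<circ> p' \<circ> g'))"
    by (rule homotopic_with_compose_continuous_map_left[OF _ g]) simp
  then have 2: "homotopic_with (\<lambda>_. True) E B' (g \<circ> f \<circ> (p' \<circ> g')) (g \<circ> p \<circ> (f' \<circ> g'))"
    by (simp add: comp_assoc homotopic_with_sym)
  have 3: "homotopic_with (\<lambda>_. True) E B' (g \<circ> p \<circ> (f' \<circ> g')) (g \<circ> p \<circ> id)"
    by (rule homotopic_with_compose_continuous_map_left[OF fg' continuous_map_compose[OF p g]])
      simp
  show ?thesis
    using homotopic_with_trans[OF homotopic_with_trans[OF 1 2] 3] by simp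
qed

text \<open>The two ends of a fibre-preserving homotopy are prescribed on the base space only,
  whereas \<^const>\<open>homotopic_with\<close> prescribes them on the whole type. Hence the passage
  through the characterisation of homotopies by their values on the space.\<close>

lemma fibre_preserving_homotopic_base:
  assumes "fibre_preserving_homotopic E B p E' B' p' (f0, g0) (f1, g1)"
  shows "homotopic_with (\<lambda>_. True) B B' g0 g1"
  using assms by (subst homotopic_with) (auto simp: fibre_preserving_homotopic_def)

lemma secat_le_of_fibre_preserving_map:
  assumes fib: "fibration E B p" and fib': "fibration E' B' p'"
    and map: "fibre_preserving_map E' B' p' E B p f' f"
    and g: "continuous_map B B' g"
    and hom: "fibre_preserving_homotopic E B p E B p (h, f \<circ> g) (id, id)"
  shows "secat m E B p \<le> secat m E' B' p'"
proof (rule secat_le_of_homotopy_square[OF fib])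
  show f: "continuous_map B' B f" "continuous_map E' E f'"
    using map by (auto simp: fibre_preserving_map_def)
  have "continuous_map E' B (p \<circ> f')"
    using fib f(2) by (auto simp: fibration_def intro: continuous_map_compose)
  then show "homotopic_with (\<lambda>_. True) E' B (p \<circ> f') (f \<circ> p')"
    by (rule homotopic_with_equal[rotated 2]) (use map in \<open>auto simp: fibre_preserving_map_def\<close>)
  show "right_homotopy_inverse B' B f g"
    using g fibre_preserving_homotopic_base[OF hom] by (simp add: right_homotopy_inverse_def)
qed

theorem proposition2p4:
  fixes E :: "'e topology" and B :: "'b topology" and p :: "'e \<Rightarrow> 'b"
    and E' :: "'f topology" and B' :: "'c topology" and p' :: "'f \<Rightarrow> 'c"
    and m :: nat
  assumes "m \<ge> 1"
    and "fibration E B p"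
    and "fibration E' B' p'"
  shows
    "(\<forall>f f'. continuous_map B' B f \<and> continuous_map E' E f' \<and>
        homotopic_with (\<lambda>_. True) E' B (p \<circ> f') (f \<circ> p') \<longrightarrow>
        ((\<exists>g. right_homotopy_inverse B' B f g) \<longrightarrow>
           secat m E B p \<le> secat m E' B' p') \<and>
        (homotopy_equivalence_map B' B f \<and> (\<exists>g'. right_homotopy_inverse E' E f' g') \<longrightarrow>
           secat m E B p = secat m E' B' p')) \<and>
     (fibre_preserving_homotopy_equivalent E B p E' B' p' \<longrightarrow>
        secat m E B p = secat m E' B' p')"
proof (intro conjI allI impI; (elim conjE exE)?)
  fix f f' g
  assume "continuous_map B' B f" "continuous_map E' E f'"
    "homotopic_with (\<lambda>_. True) E' B (p \<circ> f') (f \<circ> p')" "right_homotopy_inverse B' B f g"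
  then show "secat m E B p \<le> secat m E' B' p'"
    by (rule secat_le_of_homotopy_square[OF assms(2)])
next
  fix f f' g'
  assume f: "continuous_map B' B f" and f': "continuous_map E' E f'"
    and square: "homotopic_with (\<lambda>_. True) E' B (p \<circ> f') (f \<circ> p')"
    and "homotopy_equivalence_map B' B f" and inv': "right_homotopy_inverse E' E f' g'"
  then obtain g where g: "continuous_map B B' g" and fg: "homotopic_with (\<lambda>_. True) B B (f \<circ> g) id"
    and gf: "homotopic_with (\<lambda>_. True) B' B' (g \<circ> f) id"
    by (auto simp: homotopy_equivalence_map_def)
  have p: "continuous_map E B p" and p': "continuous_map E' B' p'"
    using assms(2,3) by (auto simp: fibration_def)
  show "secat m E B p = secat m E' B' p'"
  proof (rule antisym)
    show "secat m E B p \<le> secat m E' B' p'"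
      by (rule secat_le_of_homotopy_square[OF assms(2) f f' square])
        (use g fg in \<open>simp add: right_homotopy_inverse_def\<close>)
    show "secat m E' B' p' \<le> secat m E B p"
    proof (rule secat_le_of_homotopy_square[OF assms(3) g])
      show "continuous_map E E' g'"
        using inv' by (simp add: right_homotopy_inverse_def)
      show "homotopic_with (\<lambda>_. True) E B' (p' \<circ> g') (g \<circ> p)"
        by (rule homotopy_square_reverse[OF p p' square g gf inv'])
      show "right_homotopy_inverse B B' g f"
        using f gf by (simp add: right_homotopy_inverse_def)
    qed
  qed
next
  assume "fibre_preserving_homotopy_equivalent E B p E' B' p'"
  then obtain f g f' g' where fg: "fibre_preserving_map E B p E' B' p' f g"
      "fibre_preserving_map E' B' p' E B p f' g'"
      "fibre_preserving_homotopic E' B' p' E' B' p' (f \<circ> f', g \<circ> g') (id, id)"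
      "fibre_preserving_homotopic E B p E B p (f' \<circ> f, g' \<circ> g) (id, id)"
    unfolding fibre_preserving_homotopy_equivalent_def by blast
  then have g: "continuous_map B B' g" "continuous_map B' B g'"
    by (auto simp: fibre_preserving_map_def)
  show "secat m E B p = secat m E' B' p'"
    by (rule antisym[OF secat_le_of_fibre_preserving_map[OF assms(2,3) fg(2) g(1) fg(4)]
          secat_le_of_fibre_preserving_map[OF assms(3,2) fg(1) g(2) fg(3)]])
qed

end
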